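(* For every connected, special, reduced, alternating diagram $D$ of an oriented knot or link, let $P_D(t)=\det(S-tS^{T})$. Then $$FP(D)=-\frac{P_D'(0)}{P_D(0)}.$$ In particular, if $P_D(t)=a_0+a_1t+\cdots+a_mt^m$ with $a_0\neq 0$, then $FP(D)=-\dfrac{a_1}{a_0}$.
   Context: Diagrams. A diagram $D$ of an oriented (non-trivial) knot or link is a generic projection to the plane (a $4$-valent plane graph) with over/under information at each crossing. All diagrams are assumed to have a connected underlying projection graph ("connected"). $D$ is alternating if, travelling along each link component, over- and under-crossings alternate. $D$ is reduced if it has no nugatory crossing, i.e. no crossing at which some region of the projection meets itself from opposite corners. Smoothing all crossings of $D$ according to the orientation (Seifert's algorithm) gives a collection of Seifert circles in the plane bounding Seifert disks; $D$ is special if the Seifert disks are not nested. For a special diagram the regions of $D$ are checkerboard coloured so that the shaded regions correspond to the Seifert surface (the Seifert disks, joined by half-twisted bands at the crossings); thus the unbounded region is unshaded. Tait graph $\Gamma(D)$. Its vertices are the unshaded regions of $D$; for every crossing there is one directed edge joining the two unshaded regions meeting at that crossing (multiple edges are allowed). At a crossing, the two unshaded regions meeting there are the one lying between the two incoming arcs and the one lying between the two outgoing arcs. The edge through the crossing is directed so that the over-strand crosses the edge from left to right, the same rule being used at all crossings. The edge has weight $-1$ if the crossing is positive and $+1$ if it is negative (standard sign convention for oriented crossings). Laplacian. For a weighted directed graph $\Gamma$ with vertices $v_1,\dots,v_n$, $L(\Gamma)$ is the $n\times n$ matrix whose diagonal entry $L_{ii}$ is the weighted out-degree of $v_i$ (sum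 of the weights of the edges with initial vertex $v_i$), and whose entry $L_{ij}$, $i\ne j$, is $-1$ times the sum of the weights of the edges from $v_i$ to $v_j$. The quantities. Put $L=L(\Gamma(D))$. $FP(D)=\operatorname{tr}(L^{T}L^{+})$, where $L^{+}$ is the Moore–Penrose pseudoinverse of $L$. $S$ is the $(n-1)\times(n-1)$ principal submatrix of $L$ obtained by deleting the row and column of the vertex $v_\infty$ corresponding to the unbounded unshaded region. It is a known fact (Silver–Williams) that $S$ is a Seifert matrix of the link, so $P_D(t)$ is a polynomial representative of the one-variable Alexander polynomial, which is well defined up to multiplication by $\pm t^k$. *)

theory Defs
  imports
    "Jordan_Normal_Form.Determinant"
    "Graph_Theory.Digraph"
    "HOL-Combinatorics.Orbits"
begin

section \<open>Oriented link diagrams\<close>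

text \<open>
  A connected diagram is encoded by the combinatorial map of its underlying 4-valent plane graph.
  The basic objects are \<^emph>\<open>darts\<close> (half-edges), each thought of as pointing away from its crossing.
  \<^item> \<open>rot\<close> sends a dart to the next dart, counterclockwise, at the same crossing;
  \<^item> \<open>opp\<close> sends a dart to the other half of the same arc;
  \<^item> \<open>outgoing\<close> is the set of darts along which the orientation of the link leaves the crossing;
  \<^item> \<open>over\<close> is the set of darts lying on the over-strand of their crossing;
  \<^item> \<open>unbounded\<close> is the unbounded region, regions being the orbits of \<open>corner_step\<close> below.
\<close>

record 'd diagram =
  darts :: "'d set"
  rot :: "'d \<Rightarrow> 'd"
  opp :: "'d \<Rightarrow> 'd"
  outgoing :: "'d set"
  over :: "'d set"
  unbounded :: "'d set"

text \<open>
  A dart \<open>d\<close> also stands for the corner between \<open>d\<close> and \<open>rot d\<close>, which lies to the left when one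
  leaves the crossing along \<open>d\<close>. Walking along \<open>d\<close> with this corner's region on the left, the
  next corner of the same region is the one between the \<open>rot\<close>-predecessor of \<open>opp d\<close> and \<open>opp d\<close>.
  For \<open>d\<close> outgoing, the region to the left of the arc of \<open>d\<close> is thus \<open>region D d\<close> and the
  region to its right is \<open>region D (opp D d)\<close>.
\<close>

definition corner_step :: "'d diagram \<Rightarrow> 'd \<Rightarrow> 'd" where
  "corner_step D d = inv_into UNIV (rot D) (opp D d)"

definition region :: "'d diagram \<Rightarrow> 'd \<Rightarrow> 'd set" where
  "region D d = orbit (corner_step D) d"

definition regions :: "'d diagram \<Rightarrow> 'd set set" where
  "regions D = region D ` darts D"

text \<open>
  Both strands pass straight through a crossing, so \<open>d\<close> and \<open>rot (rot d)\<close> are the two ends of one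
  strand. For a connected map, lying on the sphere is Euler's formula V - E + F = 2; a plane
  projection is a spherical one with a distinguished region, the unbounded one. Euler's
  formula rules out the empty map, so there is at least one crossing.
\<close>

locale link_diagram =
  fixes D :: "'d diagram"
  assumes finite_darts: "finite (darts D)"
    and rot_permutes: "rot D permutes darts D"
    and four_valent: "\<And>d. d \<in> darts D \<Longrightarrow> card (orbit (rot D) d) = 4"
    and opp_permutes: "opp D permutes darts D"
    and opp_opp: "\<And>d. d \<in> darts D \<Longrightarrow> opp D (opp D d) = d"
    and opp_neq: "\<And>d. d \<in> darts D \<Longrightarrow> opp D d \<noteq> d"
    and outgoing_darts: "outgoing D \<subseteq> darts D"
    and outgoing_opp: "\<And>d. d \<in> darts D \<Longrightarrow> opp D d \<in> outgoing D \<longleftrightarrow> d \<notin> outgoing D"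
    and outgoing_strand:
      "\<And>d. d \<in> darts D \<Longrightarrow> rot D (rot D d) \<in> outgoing D \<longleftrightarrow> d \<notin> outgoing D"
    and over_darts: "over D \<subseteq> darts D"
    and over_strand: "\<And>d. d \<in> darts D \<Longrightarrow> rot D (rot D d) \<in> over D \<longleftrightarrow> d \<in> over D"
    and over_under: "\<And>d. d \<in> darts D \<Longrightarrow> rot D d \<in> over D \<longleftrightarrow> d \<notin> over D"
    and connected:
      "\<And>d e. d \<in> darts D \<Longrightarrow> e \<in> darts D \<Longrightarrow> (d, e) \<in> {(x, y). y = rot D x \<or> y = opp D x}\<^sup>*"
    and planar:
      "int (card (orbit (rot D) ` darts D)) - int (card (orbit (opp D) ` darts D))
         + int (card (regions D)) = 2"
    and unbounded_region: "unbounded D \<in> regions D"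

text \<open>
  Draw a crossing with both strands pointing upwards. Its darts, counterclockwise, are the right
  outgoing \<open>c\<close>, the left outgoing \<open>rot c\<close>, the left incoming \<open>rot (rot c)\<close> and the right incoming
  \<open>rot (rot (rot c))\<close> one. We represent a crossing by its dart \<open>c\<close>. The corners of the dart \<open>c\<close>,
  and of its images under \<open>rot\<close>, are then the upper, left, lower and right corner.
\<close>

definition crossings :: "'d diagram \<Rightarrow> 'd set" where
  "crossings D = {c \<in> darts D. c \<in> outgoing D \<and> rot D c \<in> outgoing D}"

abbreviation region_above :: "'d diagram \<Rightarrow> 'd \<Rightarrow> 'd set" where
  "region_above D c \<equiv> region D c"

abbreviation region_left :: "'d diagram \<Rightarrow> 'd \<Rightarrow> 'd set" where
  "region_left D c \<equiv> region D (rot D c)"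

abbreviation region_below :: "'d diagram \<Rightarrow> 'd \<Rightarrow> 'd set" where
  "region_below D c \<equiv> region D (rot D (rot D c))"

abbreviation region_right :: "'d diagram \<Rightarrow> 'd \<Rightarrow> 'd set" where
  "region_right D c \<equiv> region D (rot D (rot D (rot D c)))"

definition alternating :: "'d diagram \<Rightarrow> bool" where
  "alternating D \<longleftrightarrow> (\<forall>d \<in> darts D. d \<in> over D \<longleftrightarrow> opp D d \<notin> over D)"

definition nugatory :: "'d diagram \<Rightarrow> 'd \<Rightarrow> bool" where
  "nugatory D c \<longleftrightarrow>
     region_above D c = region_below D c \<or> region_left D c = region_right D c"

definition reduced :: "'d diagram \<Rightarrow> bool" where
  "reduced D \<longleftrightarrow> (\<forall>c \<in> crossings D. \<not> nugatory D c)"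

text \<open>A crossing is positive if the over-strand runs from lower left to upper right.\<close>

definition positive :: "'d diagram \<Rightarrow> 'd \<Rightarrow> bool" where
  "positive D c \<longleftrightarrow> c \<in> over D"


section \<open>Seifert circles, Seifert disks and special diagrams\<close>

text \<open>
  Arcs are represented by their outgoing darts. The oriented smoothing joins the left incoming
  to the left outgoing and the right incoming to the right outgoing dart of each crossing; an
  incoming dart \<open>x\<close> is the right one iff \<open>rot x\<close> is outgoing.
\<close>

definition seifert_step :: "'d diagram \<Rightarrow> 'd \<Rightarrow> 'd" where
  "seifert_step D d =
     (let x = opp D d in if rot D x \<in> outgoing D then rot D x else inv_into UNIV (rot D) x)"

definition seifert_circles :: "'d diagram \<Rightarrow> 'd set set" where
  "seifert_circles D = orbit (seifert_step D) ` outgoing D"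

text \<open>
  Each region of \<open>D\<close> lies, up to small neighbourhoods of the crossings, on one side of a Seifert
  circle \<open>s\<close>. One can move between regions in the complement of \<open>s\<close> by crossing an arc not on \<open>s\<close>,
  or through a smoothed crossing, where the smoothing joins the upper and the lower corner. The
  Seifert disk of \<open>s\<close> is given by the regions that are separated from the unbounded region by \<open>s\<close>.
\<close>

definition moves_off :: "'d diagram \<Rightarrow> 'd set \<Rightarrow> ('d set \<times> 'd set) set" where
  "moves_off D s =
     {(region D d, region D (opp D d)) | d. d \<in> outgoing D \<and> d \<notin> s}
     \<union> {(region_above D c, region_below D c) | c. c \<in> crossings D}"

definition seifert_disk :: "'d diagram \<Rightarrow> 'd set \<Rightarrow> 'd set set" where
  "seifert_disk D s =
     {f \<in> regions D. (unbounded D, f) \<notin> (moves_off D s \<union> (moves_off D s)\<inverse>)\<^sup>*}"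

definition special :: "'d diagram \<Rightarrow> bool" where
  "special D \<longleftrightarrow>
     (\<forall>s \<in> seifert_circles D. \<forall>s' \<in> seifert_circles D.
        s \<noteq> s' \<longrightarrow> \<not> seifert_disk D s \<subseteq> seifert_disk D s')"

definition shaded :: "'d diagram \<Rightarrow> 'd set set" where
  "shaded D = (\<Union>s \<in> seifert_circles D. seifert_disk D s)"

definition unshaded :: "'d diagram \<Rightarrow> 'd set set" where
  "unshaded D = regions D - shaded D"


section \<open>The Tait graph\<close>

text \<open>
  The edge at a crossing joins the lower and the upper region. Going upwards, left of the edge is
  left of the crossing; hence an over-strand from lower left to upper right (positive crossing)
  crosses the upward edge from left to right, and an over-strand from lower right to upper left
  (negative crossing) crosses the downward edge from left to right.
\<close>

definition tait_graph :: "'d diagram \<Rightarrow> ('d set, 'd) pre_digraph" where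
  "tait_graph D =
     \<lparr> verts = unshaded D,
       arcs = crossings D,
       tail = (\<lambda>c. if positive D c then region_below D c else region_above D c),
       head = (\<lambda>c. if positive D c then region_above D c else region_below D c) \<rparr>"

definition tait_weight :: "'d diagram \<Rightarrow> 'd \<Rightarrow> real" where
  "tait_weight D c = (if positive D c then - 1 else 1)"


section \<open>Matrices\<close>

text \<open>The list \<open>vs\<close> enumerates the vertices.\<close>

definition laplacian :: "('v, 'e) pre_digraph \<Rightarrow> ('e \<Rightarrow> real) \<Rightarrow> 'v list \<Rightarrow> real mat" where
  "laplacian G w vs = mat (length vs) (length vs)
     (\<lambda>(i, j). if i = j then (\<Sum>e \<in> out_arcs G (vs ! i). w e)
               else - (\<Sum>e \<in> out_arcs G (vs ! i) \<inter> in_arcs G (vs ! j). w e))"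

definition mat_trace :: "'a :: comm_monoid_add mat \<Rightarrow> 'a" where
  "mat_trace A = (\<Sum>i < dim_row A. A $$ (i, i))"

definition is_moore_penrose :: "real mat \<Rightarrow> real mat \<Rightarrow> bool" where
  "is_moore_penrose A X \<longleftrightarrow>
     X \<in> carrier_mat (dim_col A) (dim_row A) \<and>
     A * X * A = A \<and> X * A * X = X \<and>
     transpose_mat (A * X) = A * X \<and> transpose_mat (X * A) = X * A"

definition moore_penrose :: "real mat \<Rightarrow> real mat" where
  "moore_penrose A = (THE X. is_moore_penrose A X)"

definition tait_laplacian :: "'d diagram \<Rightarrow> 'd set list \<Rightarrow> real mat" where
  "tait_laplacian D vs = laplacian (tait_graph D) (tait_weight D) vs"

definition FP :: "'d diagram \<Rightarrow> 'd set list \<Rightarrow> real" where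
  "FP D vs =
     mat_trace (transpose_mat (tait_laplacian D vs) * moore_penrose (tait_laplacian D vs))"

text \<open>Here \<open>i\<close> is the position of the unbounded region in \<open>vs\<close>.\<close>

definition seifert_mat :: "'d diagram \<Rightarrow> 'd set list \<Rightarrow> nat \<Rightarrow> real mat" where
  "seifert_mat D vs i = mat_delete (tait_laplacian D vs) i i"

definition diagram_poly :: "'d diagram \<Rightarrow> 'd set list \<Rightarrow> nat \<Rightarrow> real poly" where
  "diagram_poly D vs i =
     (let S = map_mat (\<lambda>a. [:a:]) (seifert_mat D vs i)
      in det (S - [:0, 1:] \<cdot>\<^sub>m transpose_mat S))"

end

theory Submission
  imports Defs
begin

text \<open>
  Let \<open>L\<close> be the Laplacian of the Tait graph, \<open>n\<close> its size, \<open>E\<close> the diagonal matrix unit at the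
  position \<open>i\<close> of the unbounded region, and \<open>S\<close> the matrix \<open>L\<close> without row and column \<open>i\<close>.

  The linear algebra needs that the rows and the columns of \<open>L\<close> sum to zero and that \<open>L + E\<close> is
  invertible. Under these assumptions, Laplace expansion gives \<open>det (S - t S\<^sup>T) = det ((L + E) - t L\<^sup>T)\<close>
  (\<open>det_mat_delete_eq\<close>). The quotient of the linear by the constant coefficient of this polynomial is
  \<open>- tr ((L + E)\<^sup>-\<^sup>1 L\<^sup>T)\<close> (\<open>det_pencil_coeffs\<close>). On the other hand the pseudoinverse of \<open>L\<close> is
  \<open>Q (L + E)\<^sup>-\<^sup>1 Q\<close>, where \<open>Q\<close> is the orthogonal projection onto the vectors of sum zero, and
  \<open>tr (L\<^sup>T Q (L + E)\<^sup>-\<^sup>1 Q) = tr ((L + E)\<^sup>-\<^sup>1 L\<^sup>T)\<close> (\<open>trace_transpose_moore_penrose\<close>).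

  Rows of a loop-free Laplacian sum to zero by definition; columns do so if the graph is balanced.
  If moreover all weights are equal and the graph is connected, then the quadratic form of \<open>L\<close> is
  semidefinite with kernel the constant vectors, whence \<open>L + E\<close> is invertible
  (\<open>det_laplacian_plus_diag_unit_nonzero\<close>).

  It remains to see that the Tait graph has these properties. The main point is the checkerboard
  colouring: exactly one side of each arc is shaded (\<open>shaded_opp\<close>), and the regions above and below
  a crossing are unshaded (\<open>region_above_unshaded\<close>). It rests on two facts: every Seifert disk is
  nonempty, which comes from Euler's formula if there is a single Seifert circle and from
  non-nestedness otherwise, and no disk is contained in another one. Given the colouring,
  alternation forces all crossings to have the same sign (\<open>positive_constant\<close>), so the weights are
  equal; upper and lower corners alternate around every unshaded region, so the graph is balanced
  (\<open>card_corners\<close>); it is connected because the diagram is, and loop-free because the diagram is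
  reduced.
\<close>

section \<open>The pseudoinverse of a matrix with vanishing row and column sums\<close>

lemma is_moore_penrose_unique:
  assumes X: "is_moore_penrose A X" and Y: "is_moore_penrose A Y"
  shows "X = Y"
proof -
  obtain m n where A: "A \<in> carrier_mat m n" by blast
  note mp = X[unfolded is_moore_penrose_def] Y[unfolded is_moore_penrose_def]
  from A mp have Xc: "X \<in> carrier_mat n m" and Yc: "Y \<in> carrier_mat n m" by auto
  note c = A Xc Yc
  have AX: "A * X = A * Y"
  proof -
    have "A * X = (A * Y * A) * X" using mp by simp
    also have "\<dots> = (A * Y) * (A * X)"
      using c by (intro assoc_mult_mat[of _ m m _ n _ m]) auto
    also have "\<dots> = (A * Y)\<^sup>T * (A * X)\<^sup>T" using mp by simp
    also have "\<dots> = ((A * X) * (A * Y))\<^sup>T" using c by (simp add: transpose_mult[of _ m m _ m])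
    also have "(A * X) * (A * Y) = (A * X * A) * Y"
      using c by (intro assoc_mult_mat[symmetric, of _ m m _ n _ m]) auto
    also have "\<dots> = A * Y" using mp by simp
    finally show ?thesis using mp by simp
  qed
  have XA: "X * A = Y * A"
  proof -
    have "X * A = X * (A * Y * A)" using mp by simp
    also have "\<dots> = (X * A) * (Y * A)"
      using c by (simp add: assoc_mult_mat[of _ m n _ m _ n] assoc_mult_mat[of _ n m _ n _ n])
    also have "\<dots> = (X * A)\<^sup>T * (Y * A)\<^sup>T" using mp by simp
    also have "\<dots> = ((Y * A) * (X * A))\<^sup>T" using c by (simp add: transpose_mult[of _ n n _ n])
    also have "(Y * A) * (X * A) = Y * (A * X * A)"
      using c by (simp add: assoc_mult_mat[of _ m n _ m _ n] assoc_mult_mat[of _ n m _ n _ n])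
    also have "\<dots> = Y * A" using mp by simp
    finally show ?thesis using mp by simp
  qed
  have "X = X * A * X" using mp by simp
  also have "\<dots> = Y * A * X" using XA by simp
  also have "\<dots> = Y * (A * X)" using c by (simp add: assoc_mult_mat[of _ n m _ n _ m])
  also have "\<dots> = Y * A * Y" using AX c by (simp add: assoc_mult_mat[of _ n m _ n _ m])
  also have "\<dots> = Y" using mp by simp
  finally show ?thesis .
qed

lemma moore_penrose_eqI: "is_moore_penrose A X \<Longrightarrow> moore_penrose A = X"
  unfolding moore_penrose_def by (blast intro: the_equality is_moore_penrose_unique)

lemma mat_trace_mult_commute:
  fixes A B :: "'a :: comm_semiring_0 mat"
  assumes A: "A \<in> carrier_mat m n" and B: "B \<in> carrier_mat n m"
  shows "mat_trace (A * B) = mat_trace (B * A)"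
proof -
  have "mat_trace (A * B) = (\<Sum>i<m. \<Sum>j<n. A $$ (i, j) * B $$ (j, i))"
    using A B by (auto simp: mat_trace_def scalar_prod_def atLeast0LessThan)
  also have "\<dots> = (\<Sum>j<n. \<Sum>i<m. B $$ (j, i) * A $$ (i, j))"
    by (subst sum.swap) (simp add: mult.commute)
  also have "\<dots> = mat_trace (B * A)"
    using A B by (auto simp: mat_trace_def scalar_prod_def atLeast0LessThan)
  finally show ?thesis .
qed

text \<open>The diagonal matrix unit with entry 1 at position \<open>(i, i)\<close>.\<close>

definition diag_unit :: "nat \<Rightarrow> nat \<Rightarrow> 'a :: zero_neq_one mat" where
  "diag_unit n i = mat n n (\<lambda>(a, b). if a = i \<and> b = i then 1 else 0)"

lemma diag_unit_carrier [simp]: "diag_unit n i \<in> carrier_mat n n"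
  by (simp add: diag_unit_def)

text \<open>
  Let \<open>J\<close> be the all-ones matrix, \<open>E = diag_unit n i\<close>, and \<open>Q = 1 - J / n\<close> the orthogonal projection
  onto the vectors of sum zero. If \<open>B\<close> inverts \<open>L + E\<close>, then \<open>L * B\<close> and \<open>B * L\<close> differ from the
  identity by \<open>E * J\<close> and \<open>J * E\<close>, which \<open>Q\<close> annihilates; hence \<open>Q * B * Q\<close> is the pseudoinverse
  of \<open>L\<close>, and both projections \<open>Q\<close> are absorbed by \<open>L\<^sup>T\<close> inside the trace.
\<close>

lemma trace_transpose_moore_penrose:
  fixes L B :: "real mat"
  assumes L: "L \<in> carrier_mat n n" and B: "B \<in> carrier_mat n n" and i: "i < n"
    and rows: "\<And>a. a < n \<Longrightarrow> (\<Sum>b<n. L $$ (a, b)) = 0"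
    and cols: "\<And>b. b < n \<Longrightarrow> (\<Sum>a<n. L $$ (a, b)) = 0"
    and inv: "(L + diag_unit n i) * B = 1\<^sub>m n"
  shows "mat_trace (L\<^sup>T * moore_penrose L) = mat_trace (B * L\<^sup>T)"
proof -
  define E :: "real mat" where "E = diag_unit n i"
  define J :: "real mat" where "J = mat n n (\<lambda>_. 1)"
  define Q where "Q = 1\<^sub>m n - (1 / real n) \<cdot>\<^sub>m J"
  define X where "X = Q * B * Q"
  have c: "E \<in> carrier_mat n n" "J \<in> carrier_mat n n" "Q \<in> carrier_mat n n"
    "X \<in> carrier_mat n n" "L\<^sup>T \<in> carrier_mat n n"
    using L B by (auto simp: E_def J_def Q_def X_def)
  note [simp] = c L B c[THEN carrier_matD(1)] c[THEN carrier_matD(2)]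
    L[THEN carrier_matD(1)] L[THEN carrier_matD(2)]
  have cm [simp]: "U * V \<in> carrier_mat n n" "U + V \<in> carrier_mat n n"
    if "U \<in> carrier_mat n n" "V \<in> carrier_mat n n" for U V :: "real mat"
    using that by auto
  note assoc = assoc_mult_mat[of _ n n _ n _ n]
  have n: "real n \<noteq> 0" using i by simp
  have inv': "B * (L + E) = 1\<^sub>m n"
    using mat_mult_left_right_inverse[OF _ B inv] by (simp add: E_def)
  have inv: "(L + E) * B = 1\<^sub>m n" using inv by (simp add: E_def)
  have JL: "J * L = 0\<^sub>m n n" and LJ: "L * J = 0\<^sub>m n n"
    using L rows cols by (auto intro!: eq_matI simp: J_def scalar_prod_def atLeast0LessThan)
  have JJ: "J * J = real n \<cdot>\<^sub>m J"
    by (auto intro!: eq_matI simp: J_def scalar_prod_def)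
  have EJ: "(E * J) $$ (a, b) = (if a = i then 1 else 0)" if "a < n" "b < n" for a b
    using that i
    by (auto simp: E_def diag_unit_def J_def scalar_prod_def sum.delta' cong: if_cong)
  have EJE: "E * J * E = E"
  proof (rule eq_matI)
    fix a b assume "a < dim_row E" "b < dim_col E"
    then have ab: "a < n" "b < n" using c by auto
    then have "(E * J * E) $$ (a, b) = (\<Sum>k<n. (E * J) $$ (a, k) * E $$ (k, b))"
      using c by (auto simp: scalar_prod_def atLeast0LessThan simp del: index_mult_mat(1)
          intro!: index_mult_mat(1)[THEN trans])
    also have "\<dots> = (\<Sum>k<n. if k = i then (if a = i \<and> b = i then 1 else 0) else 0)"
      using ab EJ by (intro sum.cong) (auto simp: E_def diag_unit_def)
    also have "\<dots> = E $$ (a, b)" using i ab by (auto simp: E_def diag_unit_def)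
    finally show "(E * J * E) $$ (a, b) = E $$ (a, b)" .
  qed (use c in auto)
  have JQ: "J * Q = 0\<^sub>m n n" and QJ: "Q * J = 0\<^sub>m n n"
  proof -
    have "J * Q = J * 1\<^sub>m n - J * ((1 / real n) \<cdot>\<^sub>m J)"
      unfolding Q_def by (rule mult_minus_distrib_mat) auto
    also have "J * ((1 / real n) \<cdot>\<^sub>m J) = (1 / real n) \<cdot>\<^sub>m (real n \<cdot>\<^sub>m J)"
      using JJ by (simp add: mult_smult_distrib[of _ n n _ n])
    finally show "J * Q = 0\<^sub>m n n" using n by (auto simp: J_def intro!: eq_matI)
    have "Q * J = 1\<^sub>m n * J - ((1 / real n) \<cdot>\<^sub>m J) * J"
      unfolding Q_def by (rule minus_mult_distrib_mat) auto
    also have "((1 / real n) \<cdot>\<^sub>m J) * J = (1 / real n) \<cdot>\<^sub>m (real n \<cdot>\<^sub>m J)"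
      using JJ by (simp add: mult_smult_assoc_mat[of _ n n _ n])
    finally show "Q * J = 0\<^sub>m n n" using n by (auto simp: J_def intro!: eq_matI)
  qed
  have Q_right: "U * Q = U" if "U \<in> carrier_mat n n" "U * J = 0\<^sub>m n n" for U
  proof -
    have "U * Q = U * 1\<^sub>m n - U * ((1 / real n) \<cdot>\<^sub>m J)"
      unfolding Q_def by (rule mult_minus_distrib_mat) (use that in auto)
    also have "U * ((1 / real n) \<cdot>\<^sub>m J) = 0\<^sub>m n n"
      using that by (auto simp: mult_smult_distrib[of _ n n _ n])
    finally show ?thesis using that by (auto intro!: eq_matI)
  qed
  have Q_left: "Q * U = U" if "U \<in> carrier_mat n n" "J * U = 0\<^sub>m n n" for U
  proof -
    have "Q * U = 1\<^sub>m n * U - ((1 / real n) \<cdot>\<^sub>m J) * U"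
      unfolding Q_def by (rule minus_mult_distrib_mat) (use that in auto)
    also have "((1 / real n) \<cdot>\<^sub>m J) * U = 0\<^sub>m n n"
      using that by (auto simp: mult_smult_assoc_mat[of _ n n _ n])
    finally show ?thesis using that by (auto intro!: eq_matI)
  qed
  have QQ: "Q * Q = Q" by (rule Q_right) (auto simp: QJ)
  have LQ: "L * Q = L" by (rule Q_right) (auto simp: LJ)
  have QL: "Q * L = L" by (rule Q_left) (auto simp: JL)
  have Jsym: "J\<^sup>T = J" by (auto simp: J_def intro!: eq_matI)
  have Qsym: "Q\<^sup>T = Q" by (auto simp: Q_def J_def intro!: eq_matI)
  have LTQ: "L\<^sup>T * Q = L\<^sup>T"
    using transpose_mult[of Q n n L n] QL Qsym by simp
  have QLT: "Q * L\<^sup>T = L\<^sup>T"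
    using transpose_mult[of L n n Q n] LQ Qsym by simp
  have EB: "E * B = E * J"
  proof -
    have "J = J * ((L + E) * B)" using inv by simp
    also have "\<dots> = (J * L + J * E) * B"
      by (simp add: assoc[symmetric] mult_add_distrib_mat[of _ n n _ n])
    also have "\<dots> = J * E * B" by (simp add: JL)
    finally have "E * J = (E * J * E) * B" by (simp add: assoc)
    then show ?thesis by (simp only: EJE)
  qed
  have BE: "B * E = J * E"
  proof -
    have "J = (B * (L + E)) * J" using inv' by simp
    also have "\<dots> = B * (L * J + E * J)"
      by (simp add: assoc add_mult_distrib_mat[of _ n n _ _ n])
    also have "\<dots> = B * (E * J)" by (simp add: LJ)
    finally have "J * E = B * (E * J * E)" by (metis assoc c(1,2) cm(1) B)
    then show ?thesis by (simp only: EJE)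
  qed
  have LBQ: "L * B * Q = Q"
  proof -
    have "L * B * Q + E * B * Q = (L + E) * B * Q"
      by (simp add: add_mult_distrib_mat[of _ n n _ _ n])
    also have "\<dots> = Q" by (simp add: inv)
    finally show ?thesis by (simp add: EB assoc JQ)
  qed
  have QBL: "Q * B * L = Q"
  proof -
    have "Q * B * L + Q * B * E = Q * (B * (L + E))"
      by (simp add: mult_add_distrib_mat[of _ n n _ n] assoc)
    also have "\<dots> = Q" by (simp add: inv')
    finally show ?thesis by (simp add: BE assoc) (simp add: QJ assoc[symmetric])
  qed
  have LX: "L * X = Q"
  proof -
    have "L * X = (L * Q) * B * Q" by (simp add: X_def assoc)
    then show ?thesis by (simp add: LQ LBQ)
  qed
  have XL: "X * L = Q"
  proof -
    have "X * L = Q * B * (Q * L)" by (simp add: X_def assoc)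
    then show ?thesis by (simp add: QL QBL)
  qed
  have "X * L * X = X"
  proof -
    have "X * L * X = (Q * Q) * (B * Q)" by (simp add: XL) (simp add: X_def assoc)
    then show ?thesis by (simp add: QQ) (simp add: X_def assoc)
  qed
  then have "is_moore_penrose L X"
    using L c by (simp add: is_moore_penrose_def LX XL QL Qsym)
  then have "mat_trace (L\<^sup>T * moore_penrose L) = mat_trace (L\<^sup>T * X)"
    by (simp add: moore_penrose_eqI)
  also have "L\<^sup>T * X = (L\<^sup>T * Q) * B * Q" by (simp add: X_def assoc)
  also have "mat_trace \<dots> = mat_trace (Q * (L\<^sup>T * B))"
    by (simp only: LTQ) (rule mat_trace_mult_commute[of _ n n], auto)
  also have "Q * (L\<^sup>T * B) = (Q * L\<^sup>T) * B" by (simp add: assoc)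
  also have "mat_trace \<dots> = mat_trace (B * L\<^sup>T)"
    by (simp only: QLT) (rule mat_trace_mult_commute[of _ n n], auto)
  finally show ?thesis .
qed

section \<open>The linear coefficient of a determinant\<close>

text \<open>
  Adding 1 to a diagonal entry of a matrix adds its principal cofactor to the determinant; the
  latter is zero if the rows sum to zero.
\<close>

lemma det_mat_delete_eq:
  fixes M :: "'a :: idom mat"
  assumes M: "M \<in> carrier_mat n n" and i: "i < n"
    and rows: "\<And>a. a < n \<Longrightarrow> (\<Sum>b<n. M $$ (a, b)) = 0"
  shows "det (mat_delete M i i) = det (M + diag_unit n i)"
proof -
  let ?M = "M + diag_unit n i"
  have cof: "cofactor ?M i j = cofactor M i j" for j
  proof -
    have "mat_delete ?M i j = mat_delete M i j"
      using M by (intro eq_matI) (auto simp: mat_delete_def diag_unit_def)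
    then show ?thesis by (simp add: cofactor_def)
  qed
  have "M *\<^sub>v vec n (\<lambda>_. 1) = 0\<^sub>v n"
    using M rows by (auto intro!: eq_vecI simp: scalar_prod_def atLeast0LessThan)
  moreover have "vec n (\<lambda>_. 1) \<noteq> (0\<^sub>v n :: 'a vec)"
  proof
    assume "vec n (\<lambda>_. 1) = (0\<^sub>v n :: 'a vec)"
    then have "vec n (\<lambda>_. 1) $ i = (0\<^sub>v n :: 'a vec) $ i" by simp
    then show False using i by simp
  qed
  ultimately have "det M = 0"
    using det_0_iff_vec_prod_zero[OF M] vec_carrier by blast
  have "det ?M = (\<Sum>j<n. ?M $$ (i, j) * cofactor ?M i j)"
    using M i by (intro laplace_expansion_row) auto
  also have "\<dots> = (\<Sum>j<n. M $$ (i, j) * cofactor M i j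
      + (if j = i then cofactor M i i else 0))"
    unfolding cof using M i
    by (intro sum.cong) (auto simp: diag_unit_def distrib_right)
  also have "\<dots> = (\<Sum>j<n. M $$ (i, j) * cofactor M i j) + cofactor M i i"
    using i by (simp add: sum.distrib)
  also have "(\<Sum>j<n. M $$ (i, j) * cofactor M i j) = 0"
    using laplace_expansion_row[OF M i] \<open>det M = 0\<close> by simp
  also have "cofactor M i i = det (mat_delete M i i)" by (simp add: cofactor_def)
  finally show ?thesis by simp
qed

text \<open>
  In the Leibniz expansion a permutation other than the identity moves at least two points, hence
  contributes a multiple of the square of the indeterminate.
\<close>

lemma coeff_1_det_one_minus:
  fixes C :: "'a :: idom mat"
  assumes C: "C \<in> carrier_mat n n"
  shows "coeff (det (1\<^sub>m n - [:0, 1:] \<cdot>\<^sub>m map_mat (\<lambda>a. [:a:]) C)) 1 = - mat_trace C"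
proof -
  let ?M = "1\<^sub>m n - [:0, 1:] \<cdot>\<^sub>m map_mat (\<lambda>a. [:a:]) C"
  let ?e = "\<lambda>a b. [:if a = b then 1 else 0, - C $$ (a, b):]"
  have M: "?M $$ (a, b) = ?e a b" if "a < n" "b < n" for a b
    using that C by (auto simp: one_pCons)
  have coeff1: "coeff p 1 = poly (pderiv p) 0" for p :: "'a poly"
    by (simp add: poly_0_coeff_0 coeff_pderiv)
  have prod_coeff: "coeff (\<Prod>a = 0..<n. ?e a (p a)) 1
      = (\<Sum>a = 0..<n. (\<Prod>k \<in> {0..<n} - {a}. if k = p k then 1 else 0) * - C $$ (a, p a))" for p
    unfolding coeff1 by (simp add: pderiv_prod poly_sum poly_prod pderiv_pCons mult.commute)
  have moved: "coeff (\<Prod>a = 0..<n. ?e a (p a)) 1 = 0"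
    if p: "p permutes {0..<n}" and "p \<noteq> id" for p
    unfolding prod_coeff
  proof (rule sum.neutral, rule ballI)
    fix a assume "a \<in> {0..<n}"
    have "\<exists>k \<in> {0..<n} - {a}. k \<noteq> p k"
    proof (rule ccontr)
      assume "\<not> ?thesis"
      then have fixed: "p k = k" if "k \<noteq> a" for k
        using p that unfolding permutes_def by (metis DiffI singletonD)
      then have "p (p a) = p a \<or> p a = a" by blast
      then have "p a = a" using permutes_inj[OF p] by (auto dest: injD)
      then have "p = id" using fixed by (metis eq_id_iff)
      then show False using that by simp
    qed
    then show "(\<Prod>k \<in> {0..<n} - {a}. if k = p k then 1 else 0) * - C $$ (a, p a) = 0"
      by auto
  qed
  have "det ?M = (\<Sum>p | p permutes {0..<n}. signof p * (\<Prod>a = 0..<n. ?M $$ (a, p a)))"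
    using C by (intro det_def') auto
  also have "\<dots> = (\<Sum>p | p permutes {0..<n}. signof p * (\<Prod>a = 0..<n. ?e a (p a)))"
    by (intro sum.cong arg_cong2[where f = "(*)"] prod.cong refl M)
       (auto dest: permutes_in_image)
  finally have "coeff (det ?M) 1
      = (\<Sum>p | p permutes {0..<n}. coeff (signof p * (\<Prod>a = 0..<n. ?e a (p a))) 1)"
    by (simp only: coeff_sum)
  also have "\<dots> = (\<Sum>p \<in> {id}. coeff (signof p * (\<Prod>a = 0..<n. ?e a (p a))) 1)"
  proof (rule sum.mono_neutral_right)
    show "\<forall>p \<in> {p. p permutes {0..<n}} - {id}.
        coeff (signof p * (\<Prod>a = 0..<n. ?e a (p a))) 1 = 0"
    proof
      fix p assume p: "p \<in> {p. p permutes {0..<n}} - {id}"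
      have "signof p = (1 :: 'a poly) \<or> signof p = (- 1 :: 'a poly)"
        by (simp add: sign_def)
      then show "coeff (signof p * (\<Prod>a = 0..<n. ?e a (p a))) 1 = 0"
        using moved[of p] p by (auto simp del: One_nat_def)
    qed
  qed (auto simp: finite_permutations permutes_id)
  also have "\<dots> = (\<Sum>a = 0..<n. - C $$ (a, a))"
    using prod_coeff[of id] by simp
  also have "\<dots> = - mat_trace C" using C by (simp add: mat_trace_def sum_negf atLeast0LessThan)
  finally show ?thesis .
qed

lemma comm_ring_hom_const_poly: "comm_ring_hom (\<lambda>a :: 'a :: comm_ring_1. [:a:])"
  by unfold_locales (auto simp: one_pCons)

lemma det_pencil_coeffs:
  fixes A B C :: "'a :: field mat"
  assumes A: "A \<in> carrier_mat n n" and B: "B \<in> carrier_mat n n" and C: "C \<in> carrier_mat n n"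
    and inv: "A * C = 1\<^sub>m n"
  defines "P \<equiv> det (map_mat (\<lambda>a. [:a:]) A - [:0, 1:] \<cdot>\<^sub>m map_mat (\<lambda>a. [:a:]) B)"
  shows "coeff P 0 = det A" and "coeff P 1 = - (det A * mat_trace (C * B))"
proof -
  interpret h: comm_ring_hom "\<lambda>a :: 'a. [:a:]" by (rule comm_ring_hom_const_poly)
  interpret e: comm_ring_hom "\<lambda>p :: 'a poly. poly p 0" by unfold_locales auto
  let ?h = "map_mat (\<lambda>a. [:a:])"
  let ?N = "1\<^sub>m n - [:0, 1:] \<cdot>\<^sub>m ?h (C * B)"
  have N: "?N \<in> carrier_mat n n" using B C by (intro minus_carrier_mat) auto
  have B_eq: "B = A * (C * B)"
    using A B C inv by (simp add: assoc_mult_mat[of _ n n _ n _ n, symmetric])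
  have "?h A - [:0, 1:] \<cdot>\<^sub>m ?h B = ?h A * 1\<^sub>m n - ?h A * ([:0, 1:] \<cdot>\<^sub>m ?h (C * B))"
    using A B C B_eq h.mat_hom_mult[of A n n "C * B" n]
    by (simp add: mult_smult_distrib[of _ n n _ n])
  also have "\<dots> = ?h A * ?N"
    using A B C by (intro mult_minus_distrib_mat[symmetric, of _ n n _ n]) auto
  finally have P: "P = [:det A:] * det ?N"
    unfolding P_def using h.hom_det[of A] det_mult[of "?h A" n ?N] A N by simp
  have "map_mat (\<lambda>p. poly p 0) ?N = 1\<^sub>m n" using B C by (auto intro!: eq_matI)
  then have "poly (det ?N) 0 = 1" using e.hom_det[of ?N] by simp
  then show "coeff P 0 = det A" by (simp add: P flip: poly_0_coeff_0)
  show "coeff P 1 = - (det A * mat_trace (C * B))"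
    using coeff_1_det_one_minus[of "C * B" n] B C by (simp add: P)
qed

text \<open>
  Since the rows and the columns of \<open>L\<close> sum to zero, so do the rows of \<open>L - t L\<^sup>T\<close>, and the
  determinant of \<open>S - t S\<^sup>T\<close> equals that of \<open>(L + diag_unit n i) - t L\<^sup>T\<close>.
\<close>

theorem trace_moore_penrose_eq_coeff_ratio:
  fixes L :: "real mat"
  assumes L: "L \<in> carrier_mat n n" and i: "i < n"
    and rows: "\<And>a. a < n \<Longrightarrow> (\<Sum>b<n. L $$ (a, b)) = 0"
    and cols: "\<And>b. b < n \<Longrightarrow> (\<Sum>a<n. L $$ (a, b)) = 0"
    and det: "det (L + diag_unit n i) \<noteq> 0"
  defines "S \<equiv> map_mat (\<lambda>a. [:a:]) (mat_delete L i i)"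
  defines "P \<equiv> det (S - [:0, 1:] \<cdot>\<^sub>m S\<^sup>T)"
  shows "coeff P 0 \<noteq> 0" and "mat_trace (L\<^sup>T * moore_penrose L) = - (coeff P 1 / coeff P 0)"
proof -
  let ?h = "map_mat (\<lambda>a :: real. [:a:])"
  let ?A = "L + diag_unit n i"
  let ?M = "?h L - [:0, 1:] \<cdot>\<^sub>m ?h (L\<^sup>T)"
  have A: "?A \<in> carrier_mat n n" and M: "?M \<in> carrier_mat n n" using L by auto
  obtain B where B: "B \<in> carrier_mat n n" and AB: "?A * B = 1\<^sub>m n"
    using det_non_zero_imp_unit[OF A det] by (auto simp: Units_def ring_mat_def)
  have sum_const: "(\<Sum>x\<in>X. [:f x:]) = [:sum f X:]" for f :: "nat \<Rightarrow> real" and X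
    by (induction X rule: infinite_finite_induct) auto
  have "S - [:0, 1:] \<cdot>\<^sub>m S\<^sup>T = mat_delete ?M i i"
    using L by (intro eq_matI) (auto simp: S_def mat_delete_def)
  then have "P = det (mat_delete ?M i i)" by (simp add: P_def)
  also have "\<dots> = det (?M + diag_unit n i)"
  proof (rule det_mat_delete_eq[OF M i])
    fix a assume a: "a < n"
    have "(\<Sum>b<n. ?M $$ (a, b)) = (\<Sum>b<n. [:L $$ (a, b):] - [:0, 1:] * [:L $$ (b, a):])"
      using L a by (intro sum.cong) auto
    also have "\<dots> = [:\<Sum>b<n. L $$ (a, b):] - [:0, 1:] * [:\<Sum>b<n. L $$ (b, a):]"
      by (simp only: sum_subtractf sum_distrib_left[symmetric] sum_const)
    also have "\<dots> = 0" using rows cols a by simp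
    finally show "(\<Sum>b<n. ?M $$ (a, b)) = 0" .
  qed
  also have "?M + diag_unit n i = ?h ?A - [:0, 1:] \<cdot>\<^sub>m ?h (L\<^sup>T)"
    using L by (intro eq_matI) (auto simp: diag_unit_def one_pCons)
  finally have P: "P = det (?h ?A - [:0, 1:] \<cdot>\<^sub>m ?h (L\<^sup>T))" .
  have LT: "L\<^sup>T \<in> carrier_mat n n" using L by simp
  note coeffs = det_pencil_coeffs[OF A LT B AB, folded P]
  show "coeff P 0 \<noteq> 0" using coeffs(1) det by simp
  show "mat_trace (L\<^sup>T * moore_penrose L) = - (coeff P 1 / coeff P 0)"
    using trace_transpose_moore_penrose[OF L B i rows cols AB] coeffs det by simp
qed

section \<open>Laplacians of balanced digraphs\<close>

text \<open>
  A finite loop-free digraph with arc weights \<open>w\<close>, whose vertices are enumerated by \<open>vs\<close>.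
\<close>

locale enumerated_digraph = fin_digraph G + loopfree_digraph G
  for G :: "('v, 'e) pre_digraph" (structure) +
  fixes w :: "'e \<Rightarrow> real" and vs :: "'v list"
  assumes distinct_vs: "distinct vs" and set_vs: "set vs = verts G"
begin

lemma sum_vs: "(\<Sum>a<length vs. f (vs ! a)) = (\<Sum>v \<in> verts G. f v)"
  using sum.reindex_bij_betw[OF bij_betw_nth[OF distinct_vs refl set_vs[symmetric]], of f] by simp

lemma nth_vs: "a < length vs \<Longrightarrow> vs ! a \<in> verts G"
  using set_vs nth_mem by blast

lemma sum_out_arcs:
  "(\<Sum>v \<in> verts G. \<Sum>e \<in> out_arcs G v. f e) = (\<Sum>e \<in> arcs G. f e)" for f :: "'e \<Rightarrow> real"
  unfolding out_arcs_def by (rule sum.group) auto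

lemma sum_in_arcs:
  "(\<Sum>v \<in> verts G. \<Sum>e \<in> in_arcs G v. f e) = (\<Sum>e \<in> arcs G. f e)" for f :: "'e \<Rightarrow> real"
  unfolding in_arcs_def by (rule sum.group) auto

lemma laplacian_carrier: "laplacian G w vs \<in> carrier_mat (length vs) (length vs)"
  by (simp add: laplacian_def)

lemma laplacian_entry:
  assumes a: "a < length vs" and b: "b < length vs"
  shows "laplacian G w vs $$ (a, b)
    = (\<Sum>e \<in> out_arcs G (vs ! a). w e * (of_bool (tail G e = vs ! b) - of_bool (head G e = vs ! b)))"
proof (cases "a = b")
  case True
  have "head G e \<noteq> vs ! b" if "e \<in> out_arcs G (vs ! a)" for e
    using that no_loops[of e] True by (auto simp: out_arcs_def)
  then show ?thesis
    using a True by (auto simp: laplacian_def out_arcs_def intro!: sum.cong)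
next
  case False
  then have ne: "vs ! a \<noteq> vs ! b" using a b distinct_vs by (simp add: nth_eq_iff_index_eq)
  have "laplacian G w vs $$ (a, b) = (\<Sum>e \<in> out_arcs G (vs ! a) \<inter> {e. head G e = vs ! b}. - w e)"
    using a b False by (auto simp: laplacian_def out_arcs_def in_arcs_def sum_negf intro!: sum.cong)
  also have "\<dots> = (\<Sum>e \<in> out_arcs G (vs ! a). if head G e = vs ! b then - w e else 0)"
    by (subst sum.inter_restrict) (auto simp: out_arcs_def)
  also have "\<dots> = (\<Sum>e \<in> out_arcs G (vs ! a).
      w e * (of_bool (tail G e = vs ! b) - of_bool (head G e = vs ! b)))"
    using ne by (intro sum.cong) (auto simp: out_arcs_def)
  finally show ?thesis .
qed

lemma laplacian_apply:
  assumes a: "a < length vs"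
  shows "(\<Sum>b<length vs. laplacian G w vs $$ (a, b) * g (vs ! b))
    = (\<Sum>e \<in> out_arcs G (vs ! a). w e * (g (tail G e) - g (head G e)))"
proof -
  have "(\<Sum>b<length vs. laplacian G w vs $$ (a, b) * g (vs ! b))
    = (\<Sum>b<length vs. (\<Sum>e \<in> out_arcs G (vs ! a).
        w e * (of_bool (tail G e = vs ! b) - of_bool (head G e = vs ! b))) * g (vs ! b))"
    using a by (simp add: laplacian_entry)
  also have "\<dots> = (\<Sum>v \<in> verts G. (\<Sum>e \<in> out_arcs G (vs ! a).
        w e * (of_bool (tail G e = v) - of_bool (head G e = v))) * g v)"
    by (rule sum_vs)
  also have "\<dots> = (\<Sum>e \<in> out_arcs G (vs ! a).
      w e * ((\<Sum>v \<in> verts G. if tail G e = v then g v else 0)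
        - (\<Sum>v \<in> verts G. if head G e = v then g v else 0)))"
    unfolding sum_distrib_right sum_subtractf[symmetric] sum_distrib_left
    by (subst sum.swap) (auto simp: of_bool_def intro!: sum.cong)
  also have "\<dots> = (\<Sum>e \<in> out_arcs G (vs ! a). w e * (g (tail G e) - g (head G e)))"
    using nth_vs[OF a] by (intro sum.cong) (auto simp: out_arcs_def)
  finally show ?thesis .
qed

lemma laplacian_row_sum: "a < length vs \<Longrightarrow> (\<Sum>b<length vs. laplacian G w vs $$ (a, b)) = 0"
  using laplacian_apply[of a "\<lambda>_. 1"] by simp

text \<open>The bilinear form of the Laplacian, as a sum over the arcs.\<close>

lemma laplacian_form:
  "(\<Sum>a<length vs. h (vs ! a) * (\<Sum>b<length vs. laplacian G w vs $$ (a, b) * g (vs ! b)))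
    = (\<Sum>e \<in> arcs G. w e * h (tail G e) * (g (tail G e) - g (head G e)))"
proof -
  have "(\<Sum>a<length vs. h (vs ! a) * (\<Sum>b<length vs. laplacian G w vs $$ (a, b) * g (vs ! b)))
    = (\<Sum>a<length vs. h (vs ! a) * (\<Sum>e \<in> out_arcs G (vs ! a). w e * (g (tail G e) - g (head G e))))"
    by (simp add: laplacian_apply)
  also have "\<dots> = (\<Sum>v \<in> verts G. \<Sum>e \<in> out_arcs G v. w e * h (tail G e) * (g (tail G e) - g (head G e)))"
    by (subst sum_vs) (auto simp: sum_distrib_left out_arcs_def intro!: sum.cong)
  also have "\<dots> = (\<Sum>e \<in> arcs G. w e * h (tail G e) * (g (tail G e) - g (head G e)))"
    by (rule sum_out_arcs)
  finally show ?thesis .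
qed

text \<open>At every vertex the total weights of the outgoing and of the incoming arcs agree.\<close>

definition balanced :: bool where
  "balanced \<longleftrightarrow> (\<forall>v \<in> verts G. sum w (out_arcs G v) = sum w (in_arcs G v))"

lemma balanced_sum_tail_head:
  assumes balanced
  shows "(\<Sum>e \<in> arcs G. w e * h (tail G e)) = (\<Sum>e \<in> arcs G. w e * h (head G e))"
proof -
  have "(\<Sum>e \<in> arcs G. w e * h (tail G e)) = (\<Sum>v \<in> verts G. sum w (out_arcs G v) * h v)"
    by (subst sum_out_arcs[symmetric]) (auto simp: sum_distrib_right out_arcs_def intro!: sum.cong)
  also have "\<dots> = (\<Sum>v \<in> verts G. sum w (in_arcs G v) * h v)"
    using assms by (simp add: balanced_def)
  also have "\<dots> = (\<Sum>e \<in> arcs G. w e * h (head G e))"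
    by (subst sum_in_arcs[symmetric]) (auto simp: sum_distrib_right in_arcs_def intro!: sum.cong)
  finally show ?thesis .
qed

lemma laplacian_column_sum:
  assumes bal: balanced and b: "b < length vs"
  shows "(\<Sum>a<length vs. laplacian G w vs $$ (a, b)) = 0"
proof -
  let ?g = "\<lambda>v. of_bool (v = vs ! b) :: real"
  have pick: "(\<Sum>c<length vs. laplacian G w vs $$ (a, c) * ?g (vs ! c)) = laplacian G w vs $$ (a, b)" for a
  proof -
    have "(\<Sum>c<length vs. laplacian G w vs $$ (a, c) * ?g (vs ! c))
        = (\<Sum>c<length vs. if c = b then laplacian G w vs $$ (a, c) else 0)"
      using b distinct_vs by (intro sum.cong) (auto simp: nth_eq_iff_index_eq)
    then show ?thesis using b by simp
  qed
  have "(\<Sum>a<length vs. laplacian G w vs $$ (a, b))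
      = (\<Sum>e \<in> arcs G. w e * (?g (tail G e) - ?g (head G e)))"
    using laplacian_form[of "\<lambda>_. 1" ?g] by (simp add: pick)
  then show ?thesis
    using balanced_sum_tail_head[OF bal, of ?g] by (simp add: right_diff_distrib sum_subtractf)
qed

text \<open>
  For a balanced digraph with constant weight \<open>k\<close>, the quadratic form of the Laplacian is half of
  \<open>k\<close> times the sum of \<open>(g (tail e) - g (head e))\<^sup>2\<close> over the arcs \<open>e\<close>. A vector in the kernel of
  \<open>L + diag_unit n i\<close> vanishes at \<open>i\<close> because the columns of \<open>L\<close> sum to zero; hence it lies in the
  kernel of \<open>L\<close> and is constant by connectedness.
\<close>

lemma det_laplacian_plus_diag_unit_nonzero:
  assumes bal: balanced and k: "k \<noteq> 0" and w: "\<And>e. e \<in> arcs G \<Longrightarrow> w e = k"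
    and conn: "\<And>u v. u \<in> verts G \<Longrightarrow> v \<in> verts G \<Longrightarrow>
      (u, v) \<in> (arcs_ends G \<union> (arcs_ends G)\<inverse>)\<^sup>*"
    and i: "i < length vs"
  shows "det (laplacian G w vs + diag_unit (length vs) i) \<noteq> 0"
proof
  let ?n = "length vs"
  define L where "L = laplacian G w vs"
  have L: "L \<in> carrier_mat ?n ?n" by (simp add: L_def laplacian_carrier)
  assume "det (laplacian G w vs + diag_unit ?n i) = 0"
  then obtain x where x: "x \<in> carrier_vec ?n" "x \<noteq> 0\<^sub>v ?n" "(L + diag_unit ?n i) *\<^sub>v x = 0\<^sub>v ?n"
    using det_0_iff_vec_prod_zero[of "L + diag_unit ?n i" ?n] L by (auto simp: L_def)
  have ker: "(\<Sum>b<?n. L $$ (a, b) * x $ b) + (if a = i then x $ i else 0) = 0" if a: "a < ?n" for a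
  proof -
    have "0 = ((L + diag_unit ?n i) *\<^sub>v x) $ a" using x(3) a by simp
    also have "\<dots> = (\<Sum>b<?n. L $$ (a, b) * x $ b + (if b = i then (if a = i then x $ i else 0) else 0))"
      using x(1) a L
      by (auto simp: scalar_prod_def atLeast0LessThan diag_unit_def distrib_right intro!: sum.cong)
    also have "\<dots> = (\<Sum>b<?n. L $$ (a, b) * x $ b) + (if a = i then x $ i else 0)"
      using i by (simp add: sum.distrib)
    finally show ?thesis by simp
  qed
  have "0 = (\<Sum>a<?n. (\<Sum>b<?n. L $$ (a, b) * x $ b) + (if a = i then x $ i else 0))"
    using ker by simp
  also have "\<dots> = (\<Sum>b<?n. (\<Sum>a<?n. L $$ (a, b)) * x $ b) + x $ i"
    using i by (subst sum.distrib, subst sum.swap) (simp add: sum_distrib_right)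
  also have "\<dots> = x $ i"
    using laplacian_column_sum[OF bal] by (simp add: L_def)
  finally have xi: "x $ i = 0" by simp
  \<comment> \<open>the coordinates of \<open>x\<close> as a function on the vertices\<close>
  obtain g where g: "g (vs ! a) = x $ a" if "a < ?n" for a
  proof
    show "x $ (THE b. b < ?n \<and> vs ! b = vs ! a) = x $ a" if "a < ?n" for a
    proof -
      have "(THE b. b < ?n \<and> vs ! b = vs ! a) = a"
        using that distinct_vs by (intro the_equality) (auto simp: nth_eq_iff_index_eq)
      then show ?thesis by simp
    qed
  qed
  have Lx: "(\<Sum>b<?n. L $$ (a, b) * x $ b) = 0" if "a < ?n" for a
    using ker[OF that] xi by (simp split: if_splits)
  have "0 = (\<Sum>a<?n. g (vs ! a) * (\<Sum>b<?n. L $$ (a, b) * g (vs ! b)))"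
    using Lx g by simp
  also have "\<dots> = (\<Sum>e \<in> arcs G. k * g (tail G e) * (g (tail G e) - g (head G e)))"
    unfolding L_def laplacian_form using w by simp
  also have "\<dots> = k / 2 * (\<Sum>e \<in> arcs G. (g (tail G e) - g (head G e))\<^sup>2)
      + (\<Sum>e \<in> arcs G. k * (g (tail G e))\<^sup>2) / 2 - (\<Sum>e \<in> arcs G. k * (g (head G e))\<^sup>2) / 2"
    unfolding sum_distrib_left sum_divide_distrib sum.distrib[symmetric] sum_subtractf[symmetric]
    by (intro sum.cong) (auto simp: power2_eq_square field_simps)
  also have "(\<Sum>e \<in> arcs G. k * (g (tail G e))\<^sup>2) = (\<Sum>e \<in> arcs G. k * (g (head G e))\<^sup>2)"
    using balanced_sum_tail_head[OF bal, of "\<lambda>v. (g v)\<^sup>2"] w by simp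
  finally have "(\<Sum>e \<in> arcs G. (g (tail G e) - g (head G e))\<^sup>2) = 0" using k by simp
  then have arc: "g (tail G e) = g (head G e)" if "e \<in> arcs G" for e
    using that by (subst (asm) sum_nonneg_eq_0_iff) auto
  have const: "g u = g v" if "(u, v) \<in> (arcs_ends G \<union> (arcs_ends G)\<inverse>)\<^sup>*" for u v
    using that by induction (auto simp: arcs_ends_conv arc)
  have "x $ a = 0" if a: "a < ?n" for a
    using const[OF conn[OF nth_vs[OF a] nth_vs[OF i]]] g a i xi by simp
  then have "x = 0\<^sub>v ?n" using x(1) by (intro eq_vecI) auto
  then show False using x(2) by simp
qed

end


section \<open>Darts, crossings and regions\<close>

lemma card_orbits:
  assumes f: "f permutes A" and A: "finite A" and k: "\<And>a. a \<in> A \<Longrightarrow> card (orbit f a) = k"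
  shows "k * card (orbit f ` A) = card A"
proof -
  have perm: "permutation f" using f A permutation_permutes by blast
  have union: "\<Union> (orbit f ` A) = A"
    using permutation_self_in_orbit[OF perm] permutes_orbit_subset[OF f] by blast
  have "k * card (orbit f ` A) = card (\<Union> (orbit f ` A))"
  proof (rule card_partition)
    show "finite (orbit f ` A)" "finite (\<Union> (orbit f ` A))" using A union by auto
    show "card c = k" if "c \<in> orbit f ` A" for c using that k by auto
    show "c1 \<inter> c2 = {}" if "c1 \<in> orbit f ` A" "c2 \<in> orbit f ` A" "c1 \<noteq> c2" for c1 c2
    proof (rule ccontr)
      assume "c1 \<inter> c2 \<noteq> {}"
      then obtain x where "x \<in> c1" "x \<in> c2" by blast
      moreover from that have "cyclic_on f c1" "cyclic_on f c2"
        using cyclic_on_orbit[OF f A] by auto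
      ultimately have "c1 = orbit f x" "c2 = orbit f x" by (auto simp: cyclic_on_alldef)
      then show False using that by simp
    qed
  qed
  then show ?thesis by (simp add: union)
qed

text \<open>A connected multigraph with \<open>n\<close> edges has at most \<open>n + 1\<close> vertices.\<close>

lemma card_vertices_le_Suc_card_edges:
  assumes V: "finite V" and C: "finite C" and u: "u \<in> V"
    and ends: "\<And>c. c \<in> C \<Longrightarrow> a c \<in> V \<and> b c \<in> V"
    and conn: "\<And>v. v \<in> V \<Longrightarrow> (u, v) \<in> ({(a c, b c) | c. c \<in> C} \<union> {(a c, b c) | c. c \<in> C}\<inverse>)\<^sup>*"
  shows "card V \<le> Suc (card C)"
proof -
  \<comment> \<open>take a maximal set \<open>T\<close> of vertices that contains \<open>u\<close> and at least \<open>card T - 1\<close> edges; an edge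
    that leaves \<open>T\<close> could be added together with its other end\<close>
  define good where "good T \<longleftrightarrow> T \<subseteq> V \<and> u \<in> T \<and>
    (\<exists>X \<subseteq> C. card T \<le> Suc (card X) \<and> (\<forall>c \<in> X. a c \<in> T \<and> b c \<in> T))" for T
  have "good {u}" using u by (auto simp: good_def intro!: exI[of _ "{}"])
  moreover have "\<forall>T. good T \<longrightarrow> card T < Suc (card V)"
    by (auto simp: good_def less_Suc_eq_le intro: card_mono V)
  ultimately obtain T where T: "good T" and max: "\<And>T'. good T' \<Longrightarrow> card T' \<le> card T"
    using ex_has_greatest_nat[of good "{u}" card "Suc (card V)"] by blast
  from T obtain X where TX: "T \<subseteq> V" "u \<in> T" "X \<subseteq> C" "card T \<le> Suc (card X)"
    "\<forall>c \<in> X. a c \<in> T \<and> b c \<in> T" by (auto simp: good_def)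
  have fin: "finite T" "finite X" using TX V C finite_subset by blast+
  have closed: "z \<in> T" if "y \<in> T" "c \<in> C" "y = a c \<and> z = b c \<or> y = b c \<and> z = a c" for y z c
  proof (rule ccontr)
    assume z: "z \<notin> T"
    then have "c \<notin> X" using that TX by auto
    then have "good (insert z T)"
      using z that TX fin ends[OF that(2)]
      by (auto simp: good_def intro!: exI[of _ "insert c X"])
    then show False using max[of "insert z T"] z fin by simp
  qed
  have "V \<subseteq> T"
  proof
    fix v assume "v \<in> V"
    from conn[OF this] show "v \<in> T" by induction (use TX closed in blast)+
  qed
  then have "card V \<le> Suc (card X)" using TX fin card_mono[of T V] by simp
  also have "\<dots> \<le> Suc (card C)" using TX C by (simp add: card_mono)
  finally show ?thesis .
qed

context link_diagram
begin

lemma rot_in [simp]: "rot D d \<in> darts D \<longleftrightarrow> d \<in> darts D"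
  using permutes_in_image[OF rot_permutes] .

lemma opp_in [simp]: "opp D d \<in> darts D \<longleftrightarrow> d \<in> darts D"
  using permutes_in_image[OF opp_permutes] .

lemma inv_rot_rot [simp]: "inv_into UNIV (rot D) (rot D d) = d"
  using permutes_inverses[OF rot_permutes] by simp

lemma opp_opp' [simp]: "opp D (opp D d) = d"
  using opp_opp permutes_not_in[OF opp_permutes] by (cases "d \<in> darts D") auto

lemma rot_rot_rot_rot [simp]: "rot D (rot D (rot D (rot D d))) = d"
proof (cases "d \<in> darts D")
  case True
  have "permutation (rot D)" using rot_permutes finite_darts permutation_permutes by blast
  then have self: "d \<in> orbit (rot D) d" by (rule permutation_self_in_orbit)
  have "card (orbit (rot D) d) = funpow_dist1 (rot D) d d"
    using inj_on_funpow_dist1[OF self] orbit_conv_funpow_dist1[OF self]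
    by (simp add: card_image)
  then have "funpow_dist1 (rot D) d d = 4" using four_valent True by simp
  then show ?thesis using funpow_dist1_prop[OF self] by (simp add: numeral_eq_Suc)
next
  case False
  then show ?thesis using permutes_not_in[OF rot_permutes] by simp
qed

lemma outgoing_in: "d \<in> outgoing D \<Longrightarrow> d \<in> darts D"
  using outgoing_darts by blast

lemma crossing_in: "c \<in> crossings D \<Longrightarrow> c \<in> darts D"
  by (simp add: crossings_def)

lemma crossing_outgoing:
  assumes "c \<in> crossings D"
  shows "c \<in> outgoing D" "rot D c \<in> outgoing D" "rot D (rot D c) \<notin> outgoing D"
    "rot D (rot D (rot D c)) \<notin> outgoing D"
  using assms outgoing_strand[of c] outgoing_strand[of "rot D c"] by (auto simp: crossings_def)

lemma outgoing_cases:
  assumes "d \<in> outgoing D"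
  obtains c where "c \<in> crossings D" "d = c" | c where "c \<in> crossings D" "d = rot D c"
proof (cases "rot D d \<in> outgoing D")
  case True
  then show ?thesis using assms that outgoing_in by (auto simp: crossings_def)
next
  case False
  have d: "d \<in> darts D" using assms by (rule outgoing_in)
  have "rot D (rot D (rot D d)) \<in> outgoing D" using outgoing_strand[of "rot D d"] d False by simp
  then have "rot D (rot D (rot D d)) \<in> crossings D" using d assms by (simp add: crossings_def)
  then show ?thesis using that(2)[of "rot D (rot D (rot D d))"] by simp
qed

lemma incoming_cases:
  assumes "d \<in> darts D" "d \<notin> outgoing D"
  obtains c where "c \<in> crossings D" "d = rot D (rot D c)"
    | c where "c \<in> crossings D" "d = rot D (rot D (rot D c))"
proof -
  have "rot D (rot D d) \<in> outgoing D" using assms outgoing_strand by simp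
  then show ?thesis
  proof (cases rule: outgoing_cases)
    case (1 c)
    then have "d = rot D (rot D c)" by (metis rot_rot_rot_rot)
    then show ?thesis using 1 that by blast
  next
    case (2 c)
    then have "d = rot D (rot D (rot D c))" by (metis rot_rot_rot_rot)
    then show ?thesis using 2 that by blast
  qed
qed

lemma finite_crossings: "finite (crossings D)"
  using finite_darts by (rule finite_subset[rotated]) (auto simp: crossings_def)

lemma finite_regions: "finite (regions D)"
  by (simp add: regions_def finite_darts)

lemma region_in [simp]: "d \<in> darts D \<Longrightarrow> region D d \<in> regions D"
  by (simp add: regions_def)

text \<open>The region of the corner at \<open>d\<close> lies to the right of the dart \<open>rot d\<close>.\<close>

lemma region_opp_rot [simp]: "region D (opp D (rot D d)) = region D d"
proof -
  have "corner_step D = inv_into UNIV (rot D) \<circ> opp D" by (simp add: corner_step_def fun_eq_iff)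
  then have "corner_step D permutes darts D"
    using rot_permutes opp_permutes by (auto intro: permutes_compose permutes_inv)
  then have "permutation (corner_step D)" using finite_darts permutation_permutes by blast
  from permutation_orbit_step[OF this, of "opp D (rot D d)"] show ?thesis
    by (simp add: region_def corner_step_def)
qed

lemma region_opp: "region D (opp D d) = region D (rot D (rot D (rot D d)))"
  using region_opp_rot[of "rot D (rot D (rot D d))"] by (simp del: region_opp_rot)

lemma dart_invariant:
  assumes "\<And>d. d \<in> darts D \<Longrightarrow> Q (rot D d) = Q d" and "\<And>d. d \<in> darts D \<Longrightarrow> Q (opp D d) = Q d"
    and d: "d \<in> darts D" and e: "e \<in> darts D"
  shows "Q d = Q e"
proof -
  have "e \<in> darts D \<and> Q d = Q e" using connected[OF d e]
    by induction (use assms in auto)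
  then show ?thesis by simp
qed

text \<open>Regions are connected with each other through the arcs of the diagram.\<close>

lemma region_invariant:
  assumes "\<And>d. d \<in> outgoing D \<Longrightarrow> Q (region D d) = Q (region D (opp D d))"
    and d: "d \<in> darts D" and e: "e \<in> darts D"
  shows "Q (region D d) = Q (region D e)"
proof -
  have opp: "Q (region D (opp D x)) = Q (region D x)" if "x \<in> darts D" for x
    using assms(1)[of x] assms(1)[of "opp D x"] outgoing_opp[OF that] by auto
  show ?thesis
  proof (rule dart_invariant[where Q = "\<lambda>x. Q (region D x)", OF _ opp d e])
    show "Q (region D (rot D x)) = Q (region D x)" if "x \<in> darts D" for x
      using opp[of "rot D x"] that by simp
  qed
qed

text \<open>Euler's formula for a diagram with \<open>n\<close> crossings, hence \<open>2 n\<close> arcs.\<close>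

lemma card_regions: "card (regions D) = card (crossings D) + 2"
proof -
  have perm: "permutation (rot D)" using rot_permutes finite_darts permutation_permutes by blast
  have orbit_rot: "orbit (rot D) d = {d, rot D d, rot D (rot D d), rot D (rot D (rot D d))}" for d
  proof -
    have "orbit (rot D) d = {(rot D ^^ m) d | m. m < 4}"
      by (rule orbit_altdef_bounded) (simp_all add: numeral_eq_Suc)
    also have "\<dots> = (\<lambda>m. (rot D ^^ m) d) ` {..<4}" by auto
    also have "{..<4} = {0, 1, 2, 3 :: nat}" by auto
    finally show ?thesis by (simp add: numeral_eq_Suc)
  qed
  have "orbit (rot D) ` darts D = orbit (rot D) ` crossings D"
  proof
    show "orbit (rot D) ` darts D \<subseteq> orbit (rot D) ` crossings D"
    proof
      fix o' assume "o' \<in> orbit (rot D) ` darts D"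
      then obtain d where d: "d \<in> darts D" "o' = orbit (rot D) d" by blast
      have "\<exists>c \<in> crossings D. d \<in> orbit (rot D) c"
        using d(1) orbit_rot by (cases "d \<in> outgoing D") (auto elim!: outgoing_cases incoming_cases)
      then obtain c where "c \<in> crossings D" "d \<in> orbit (rot D) c" by blast
      then show "o' \<in> orbit (rot D) ` crossings D"
        using d(2) cyclic_on_orbit[OF rot_permutes finite_darts, of c] by (auto simp: cyclic_on_alldef)
    qed
  qed (auto dest: crossing_in)
  moreover have "inj_on (orbit (rot D)) (crossings D)"
  proof (rule inj_onI)
    fix c c' assume c: "c \<in> crossings D" "c' \<in> crossings D" "orbit (rot D) c = orbit (rot D) c'"
    then have "c' \<in> orbit (rot D) c" using permutation_self_in_orbit[OF perm] by simp
    then show "c = c'"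
      using crossing_outgoing[OF c(1)] crossing_outgoing[OF c(2)] by (auto simp: orbit_rot)
  qed
  ultimately have V: "card (orbit (rot D) ` darts D) = card (crossings D)"
    by (simp add: card_image)
  have "card (orbit (opp D) d) = 2" if "d \<in> darts D" for d
  proof -
    have "orbit (opp D) d = {(opp D ^^ m) d | m. m < 2}"
      by (rule orbit_altdef_bounded) (simp_all add: numeral_eq_Suc)
    also have "\<dots> = (\<lambda>m. (opp D ^^ m) d) ` {..<2}" by auto
    also have "{..<2} = {0, 1 :: nat}" by auto
    finally show ?thesis using opp_neq[OF that] by simp
  qed
  then have "2 * card (orbit (opp D) ` darts D) = card (darts D)"
    by (rule card_orbits[OF opp_permutes finite_darts])
  moreover have "4 * card (orbit (rot D) ` darts D) = card (darts D)"
    using card_orbits[OF rot_permutes finite_darts four_valent] .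
  ultimately show ?thesis using planar V by linarith
qed

section \<open>Seifert circles and their two sides\<close>

lemma seifert_step_cases:
  assumes d: "d \<in> outgoing D"
  obtains c where "c \<in> crossings D" "opp D d = rot D (rot D (rot D c))" "seifert_step D d = c"
    | c where "c \<in> crossings D" "opp D d = rot D (rot D c)" "seifert_step D d = rot D c"
proof -
  have "opp D d \<in> darts D" "opp D d \<notin> outgoing D" using d outgoing_in outgoing_opp by auto
  then show ?thesis
  proof (cases rule: incoming_cases)
    case (1 c)
    then have "seifert_step D d = rot D c"
      using crossing_outgoing by (simp add: seifert_step_def)
    then show ?thesis using 1 that by blast
  next
    case (2 c)
    then have "seifert_step D d = c" using crossing_outgoing by (simp add: seifert_step_def)
    then show ?thesis using 2 that by blast
  qed
qed

lemma seifert_step_outgoing: "d \<in> outgoing D \<Longrightarrow> seifert_step D d \<in> outgoing D"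
  by (erule seifert_step_cases) (auto intro: crossing_outgoing)

text \<open>
  By its definition, an orbit consists of the proper iterates only; it contains its base point here
  because \<open>seifert_step\<close> permutes the finite set of outgoing darts.
\<close>

lemma outgoing_in_seifert_circle:
  assumes d: "d \<in> outgoing D"
  shows "d \<in> orbit (seifert_step D) d"
proof -
  let ?f = "\<lambda>x. if x \<in> outgoing D then seifert_step D x else x"
  have fin: "finite (outgoing D)" using outgoing_darts finite_darts finite_subset by blast
  have inj: "inj_on (seifert_step D) (outgoing D)"
  proof (rule inj_onI)
    fix x y assume xy: "x \<in> outgoing D" "y \<in> outgoing D" "seifert_step D x = seifert_step D y"
    have "opp D x = opp D y"
      using xy(1)
    proof (cases rule: seifert_step_cases)
      case x: (1 c)
      from xy(2) show ?thesis
      proof (cases rule: seifert_step_cases)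
        case (2 c')
        then show ?thesis using x xy(3) crossing_outgoing[of c] crossing_outgoing[of c'] by simp
      qed (use x xy(3) in simp)
    next
      case x: (2 c)
      from xy(2) show ?thesis
      proof (cases rule: seifert_step_cases)
        case (1 c')
        then show ?thesis using x xy(3) crossing_outgoing[of c] crossing_outgoing[of c'] by auto
      next
        case (2 c')
        then have "c = c'" using x xy(3) by (metis inv_rot_rot)
        then show ?thesis using x 2 by simp
      qed
    qed
    then show "x = y" by (metis opp_opp')
  qed
  then have "bij_betw (seifert_step D) (outgoing D) (outgoing D)"
    using fin seifert_step_outgoing by (simp add: bij_betw_def endo_inj_surj image_subsetI)
  then have "bij_betw ?f (outgoing D) (outgoing D)"
    by (rule bij_betw_cong[THEN iffD1, rotated]) simp
  then have "?f permutes outgoing D" by (rule bij_imp_permutes) simp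
  then have "permutation ?f" using fin permutation_permutes by blast
  then have "d \<in> orbit ?f d" by (rule permutation_self_in_orbit)
  moreover have "y \<in> orbit (seifert_step D) d \<and> y \<in> outgoing D" if "y \<in> orbit ?f d" for y
    using that
    by induction (use d seifert_step_outgoing in \<open>auto intro: orbit.intros\<close>)
  ultimately show ?thesis by blast
qed

text \<open>
  The regions that communicate through smoothed crossings alone, that is, those that lie in one
  component of the complement of all Seifert circles.
\<close>

definition through_crossings :: "('d set \<times> 'd set) set" where
  "through_crossings =
     ({(region_above D c, region_below D c) | c. c \<in> crossings D}
       \<union> {(region_above D c, region_below D c) | c. c \<in> crossings D}\<inverse>)\<^sup>*"

text \<open>
  The regions that communicate off \<open>s\<close>, that is, those on the same side of the Seifert circle \<open>s\<close>.
\<close>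

definition connected_off :: "'d set \<Rightarrow> ('d set \<times> 'd set) set" where
  "connected_off s = (moves_off D s \<union> (moves_off D s)\<inverse>)\<^sup>*"

lemma connected_off_sym: "(f, g) \<in> connected_off s \<Longrightarrow> (g, f) \<in> connected_off s"
  unfolding connected_off_def by (meson sym_Un_converse sym_rtrancl symD)

lemma connected_off_trans:
  "(f, g) \<in> connected_off s \<Longrightarrow> (g, h) \<in> connected_off s \<Longrightarrow> (f, h) \<in> connected_off s"
  unfolding connected_off_def by (rule rtrancl_trans)

lemma through_crossings_connected_off: "through_crossings \<subseteq> connected_off s"
  unfolding through_crossings_def connected_off_def moves_off_def by (rule rtrancl_mono) blast

lemma seifert_disk_iff:
  "f \<in> seifert_disk D s \<longleftrightarrow> f \<in> regions D \<and> (unbounded D, f) \<notin> connected_off s"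
  by (simp add: seifert_disk_def connected_off_def)

lemma unbounded_notin_disk: "unbounded D \<notin> seifert_disk D s"
  by (simp add: seifert_disk_def)

lemma disk_cong:
  "(f, g) \<in> connected_off s \<Longrightarrow> f \<in> regions D \<Longrightarrow> g \<in> regions D \<Longrightarrow>
    f \<in> seifert_disk D s \<longleftrightarrow> g \<in> seifert_disk D s"
  unfolding seifert_disk_iff using connected_off_sym connected_off_trans by blast

lemma disk_cong_off:
  assumes "d \<in> outgoing D" "d \<notin> s"
  shows "region D d \<in> seifert_disk D s \<longleftrightarrow> region D (opp D d) \<in> seifert_disk D s"
proof (rule disk_cong)
  show "(region D d, region D (opp D d)) \<in> connected_off s"
    using assms unfolding connected_off_def moves_off_def by blast
qed (use assms outgoing_in in auto)

lemma disk_cong_through: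
  "(f, g) \<in> through_crossings \<Longrightarrow> f \<in> regions D \<Longrightarrow> g \<in> regions D \<Longrightarrow>
    f \<in> seifert_disk D s \<longleftrightarrow> g \<in> seifert_disk D s"
  using disk_cong through_crossings_connected_off by blast

text \<open>
  The regions on the left of a Seifert circle communicate with each other through the crossings,
  and so do those on its right.
\<close>

lemma seifert_step_sides:
  assumes d: "d \<in> outgoing D"
  shows "(region D d, region D (seifert_step D d)) \<in> through_crossings"
    and "(region D (opp D d), region D (opp D (seifert_step D d))) \<in> through_crossings"
proof -
  have step: "(region D (rot D (rot D c)), region D c) \<in> through_crossings" if "c \<in> crossings D" for c
    using that unfolding through_crossings_def by blast
  have refl: "(f, f) \<in> through_crossings" for f by (simp add: through_crossings_def)
  have left: "region D d = region D (rot D (rot D (rot D (opp D d))))"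
    using region_opp[of "opp D d"] by simp
  show "(region D d, region D (seifert_step D d)) \<in> through_crossings"
    using d by (cases rule: seifert_step_cases) (auto simp: left step refl)
  show "(region D (opp D d), region D (opp D (seifert_step D d))) \<in> through_crossings"
    using d by (cases rule: seifert_step_cases) (auto simp: region_opp[of "seifert_step D d"] step refl)
qed

lemma seifert_circle_sides:
  assumes d: "d \<in> outgoing D" and e: "e \<in> orbit (seifert_step D) d"
  shows "(region D d, region D e) \<in> through_crossings"
    and "(region D (opp D d), region D (opp D e)) \<in> through_crossings"
proof -
  have "e \<in> outgoing D \<and> (region D d, region D e) \<in> through_crossings
    \<and> (region D (opp D d), region D (opp D e)) \<in> through_crossings"
    using e
  proof induction
    case base
    then show ?case using d seifert_step_sides seifert_step_outgoing by blast
  next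
    case (step y)
    then show ?case using seifert_step_sides[of y] seifert_step_outgoing[of y]
      unfolding through_crossings_def by (auto intro: rtrancl_trans)
  qed
  then show "(region D d, region D e) \<in> through_crossings"
    "(region D (opp D d), region D (opp D e)) \<in> through_crossings" by auto
qed

text \<open>A Seifert circle with a nonempty disk has exactly one of its two sides in the disk.\<close>

lemma seifert_disk_one_side:
  assumes d: "d \<in> outgoing D" and ne: "seifert_disk D (orbit (seifert_step D) d) \<noteq> {}"
  defines "s \<equiv> orbit (seifert_step D) d"
  shows "region D d \<in> seifert_disk D s \<longleftrightarrow> region D (opp D d) \<notin> seifert_disk D s"
proof (rule ccontr)
  assume eq: "\<not> ?thesis"
  have same: "region D e \<in> seifert_disk D s \<longleftrightarrow> region D (opp D e) \<in> seifert_disk D s"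
    if e: "e \<in> outgoing D" for e
  proof (cases "e \<in> s")
    case True
    note sides = seifert_circle_sides[OF d True[unfolded s_def]]
    show ?thesis
      using eq disk_cong_through[OF sides(1), of s] disk_cong_through[OF sides(2), of s] d e outgoing_in
      by auto
  qed (rule disk_cong_off[OF e])
  obtain u where u: "u \<in> darts D" "unbounded D = region D u"
    using unbounded_region by (auto simp: regions_def)
  obtain v where v: "v \<in> darts D" "region D v \<in> seifert_disk D s"
    using ne by (auto simp: s_def seifert_disk_def regions_def)
  show False
    using region_invariant[of "\<lambda>f. f \<in> seifert_disk D s", OF same u(1) v(1)] u(2) v(2)
      unbounded_notin_disk[of s] by simp
qed

section \<open>The checkerboard colouring of a special diagram\<close>

context
  assumes special: "special D"
begin

text \<open>
  If there are two Seifert circles, an empty disk would be nested in another one. If there is only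
  one, then every arc is on it, so the only moves off it are those through the crossings; by
  Euler's formula the number of crossings is too small for them to connect all regions.
\<close>

lemma seifert_disk_nonempty:
  assumes s: "s \<in> seifert_circles D"
  shows "seifert_disk D s \<noteq> {}"
proof
  assume empty: "seifert_disk D s = {}"
  then have only: "s' = s" if "s' \<in> seifert_circles D" for s'
    using that s special by (auto simp: special_def)
  have "d \<in> s" if "d \<in> outgoing D" for d
    using only[of "orbit (seifert_step D) d"] outgoing_in_seifert_circle[OF that] that
    by (auto simp: seifert_circles_def)
  then have moves: "moves_off D s = {(region_above D c, region_below D c) | c. c \<in> crossings D}"
    by (auto simp: moves_off_def)
  have "card (regions D) \<le> Suc (card (crossings D))"
  proof (rule card_vertices_le_Suc_card_edges[OF finite_regions finite_crossings unbounded_region])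
    show "region_above D c \<in> regions D \<and> region_below D c \<in> regions D" if "c \<in> crossings D" for c
      using crossing_in[OF that] by simp
    show "(unbounded D, v) \<in> ({(region_above D c, region_below D c) | c. c \<in> crossings D}
        \<union> {(region_above D c, region_below D c) | c. c \<in> crossings D}\<inverse>)\<^sup>*" if "v \<in> regions D" for v
      using that empty by (auto simp: seifert_disk_def moves)
  qed
  then show False by (simp add: card_regions)
qed

lemma seifert_disk_one_side':
  "d \<in> outgoing D \<Longrightarrow> region D d \<in> seifert_disk D (orbit (seifert_step D) d) \<longleftrightarrow>
    region D (opp D d) \<notin> seifert_disk D (orbit (seifert_step D) d)"
  using seifert_disk_one_side seifert_disk_nonempty by (simp add: seifert_circles_def)

text \<open>
  Let \<open>f\<close> be the region next to a Seifert circle \<open>s\<close> that is not in the disk of \<open>s\<close>. If \<open>f\<close> were in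
  the disk of another circle \<open>s'\<close>, then every region reached from the unbounded one without
  crossing \<open>s'\<close> would be reached without crossing \<open>s\<close>: crossing \<open>s\<close> means passing the side of \<open>f\<close>.
  So the disk of \<open>s\<close> would be nested in the disk of \<open>s'\<close>.
\<close>

lemma outer_side_unshaded:
  assumes d: "d \<in> outgoing D" and f: "f \<in> {region D d, region D (opp D d)}"
    and out: "f \<notin> seifert_disk D (orbit (seifert_step D) d)"
  shows "f \<notin> shaded D"
proof
  define s where "s = orbit (seifert_step D) d"
  have fR: "f \<in> regions D" using f d outgoing_in by auto
  assume "f \<in> shaded D"
  then obtain s' where s': "s' \<in> seifert_circles D" "f \<in> seifert_disk D s'"
    by (auto simp: shaded_def)
  have s: "s \<in> seifert_circles D" using d by (auto simp: s_def seifert_circles_def)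
  have reach: "g \<in> regions D \<and> g \<notin> seifert_disk D s" if "(unbounded D, g) \<in> connected_off s'" for g
    using that unfolding connected_off_def
  proof induction
    case base
    then show ?case using unbounded_notin_disk unbounded_region by blast
  next
    case (step y z)
    then have yz: "(y, z) \<in> connected_off s'" "(unbounded D, y) \<in> connected_off s'"
      unfolding connected_off_def by auto
    then have "(unbounded D, z) \<in> connected_off s'" by (metis connected_off_trans)
    then have off: "y \<notin> seifert_disk D s'" "z \<notin> seifert_disk D s'"
      using yz by (auto simp: seifert_disk_iff)
    have zR: "z \<in> regions D"
      using step.hyps crossing_in outgoing_in by (auto simp: moves_off_def)
    show ?case
    proof (cases "(y, z) \<in> moves_off D s \<union> (moves_off D s)\<inverse>")
      case True
      then have "(y, z) \<in> connected_off s" unfolding connected_off_def by blast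
      then show ?thesis using disk_cong step.IH zR by blast
    next
      case False
      then obtain e where e: "e \<in> outgoing D" "e \<in> s"
        "(y, z) = (region D e, region D (opp D e)) \<or> (z, y) = (region D e, region D (opp D e))"
        using step.hyps(2) by (auto simp: moves_off_def)
      note sides = seifert_circle_sides[OF d e(2)[unfolded s_def]]
      have "(f, y) \<in> through_crossings \<or> (f, z) \<in> through_crossings"
        using f e(3) sides by auto
      then have "f \<notin> seifert_disk D s'"
        using disk_cong_through[OF _ fR, of y s'] disk_cong_through[OF _ fR, of z s'] off step.IH zR
        by blast
      then show ?thesis using s' by blast
    qed
  qed
  have "seifert_disk D s \<subseteq> seifert_disk D s'"
    using reach by (auto simp: seifert_disk_iff)
  moreover have "s \<noteq> s'" using out s'(2) by (auto simp: s_def)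
  ultimately show False using special s s' by (auto simp: special_def)
qed

lemma shaded_opp:
  assumes d: "d \<in> darts D"
  shows "region D (opp D d) \<in> shaded D \<longleftrightarrow> region D d \<notin> shaded D"
proof -
  have *: "region D (opp D e) \<in> shaded D \<longleftrightarrow> region D e \<notin> shaded D" if e: "e \<in> outgoing D" for e
  proof -
    let ?s = "orbit (seifert_step D) e"
    have s: "?s \<in> seifert_circles D" using e by (simp add: seifert_circles_def)
    show ?thesis
    proof (cases "region D e \<in> seifert_disk D ?s")
      case True
      then show ?thesis
        using outer_side_unshaded[OF e, of "region D (opp D e)"] seifert_disk_one_side'[OF e] s
        by (auto simp: shaded_def)
    next
      case False
      then show ?thesis
        using outer_side_unshaded[OF e, of "region D e"] seifert_disk_one_side'[OF e] s
        by (auto simp: shaded_def)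
    qed
  qed
  show ?thesis
    using *[of d] *[of "opp D d"] outgoing_opp[OF d] by (cases "d \<in> outgoing D") auto
qed

lemma shaded_rot:
  assumes d: "d \<in> darts D"
  shows "region D (rot D d) \<in> shaded D \<longleftrightarrow> region D d \<notin> shaded D"
  using shaded_opp[of "rot D d"] d by simp

text \<open>
  Were the region above a crossing shaded, the regions left and right of the crossing would not be.
  The region above would then lie in the disk of the Seifert circle on the right; but it is reached
  from the unshaded region on the left by crossing only the Seifert circle on the left.
\<close>

lemma region_above_unshaded:
  assumes c: "c \<in> crossings D"
  shows "region_above D c \<notin> shaded D"
proof
  assume sh: "region_above D c \<in> shaded D"
  note cr = crossing_outgoing[OF c] crossing_in[OF c]
  let ?s = "orbit (seifert_step D) c"
  have s: "?s \<in> seifert_circles D" using cr by (simp add: seifert_circles_def)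
  have "region D (opp D c) \<notin> seifert_disk D ?s"
    using shaded_opp[of c] sh cr s by (auto simp: shaded_def)
  then have in_disk: "region D c \<in> seifert_disk D ?s"
    and out: "region D (opp D c) \<notin> seifert_disk D ?s"
    using seifert_disk_one_side'[of c] cr by auto
  have "rot D c \<notin> ?s"
  proof
    \<comment> \<open>the region above is left of the right strand, but right of the left strand\<close>
    assume "rot D c \<in> ?s"
    from seifert_circle_sides(2)[OF _ this] have "(region D (opp D c), region D c) \<in> through_crossings"
      using cr by simp
    then show False using disk_cong_through[of _ _ ?s] in_disk out cr by auto
  qed
  from disk_cong_off[OF _ this] have "region D (rot D c) \<in> seifert_disk D ?s"
    using cr in_disk by simp
  then show False using shaded_rot[of c] sh cr s by (auto simp: shaded_def)
qed

lemma region_below_unshaded: "c \<in> crossings D \<Longrightarrow> region_below D c \<notin> shaded D"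
  using region_above_unshaded[of c] shaded_rot[of c] shaded_rot[of "rot D c"] crossing_in[of c] by simp

section \<open>The Tait graph of a special alternating diagram\<close>

text \<open>
  Being over flips along an arc and from one dart to the next at a crossing, and so does the
  shading of the region to the left. At a crossing the two agree or disagree according to the sign.
\<close>

lemma positive_constant:
  assumes alt: "alternating D" and c: "c \<in> crossings D" and c': "c' \<in> crossings D"
  shows "positive D c \<longleftrightarrow> positive D c'"
proof -
  let ?Q = "\<lambda>d. d \<in> over D \<longleftrightarrow> region D d \<notin> shaded D"
  have "?Q c = ?Q c'"
  proof (rule dart_invariant[of ?Q])
    show "?Q (rot D d) = ?Q d" if "d \<in> darts D" for d
      using over_under[OF that] shaded_rot[OF that] by auto
    show "?Q (opp D d) = ?Q d" if d: "d \<in> darts D" for d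
    proof -
      have "opp D d \<in> over D \<longleftrightarrow> d \<notin> over D" using alt d unfolding alternating_def by blast
      then show ?thesis using shaded_opp[OF d] by auto
    qed
  qed (use c c' crossing_in in auto)
  then show ?thesis
    using region_above_unshaded[OF c] region_above_unshaded[OF c'] by (simp add: positive_def)
qed

text \<open>
  Along the boundary of an unshaded region, upper and lower corners alternate: next to the upper
  corner at \<open>c\<close> is the lower corner at the crossing \<open>rot (opp c)\<close>.
\<close>

lemma next_crossing_bij: "bij_betw (\<lambda>c. rot D (opp D c)) (crossings D) (crossings D)"
proof -
  have "rot D (opp D c) \<in> crossings D" if c: "c \<in> crossings D" for c
  proof -
    have "opp D c \<in> darts D" "opp D c \<notin> outgoing D"
      using crossing_in[OF c] outgoing_opp crossing_outgoing[OF c] by auto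
    then show ?thesis
    proof (cases rule: incoming_cases)
      case (1 c')
      then show ?thesis
        using shaded_opp[of c] region_above_unshaded[OF c] region_below_unshaded[of c'] crossing_in[OF c]
        by simp
    qed auto
  qed
  moreover have "inj_on (\<lambda>c. rot D (opp D c)) (crossings D)"
    by (rule inj_onI) (metis inv_rot_rot opp_opp')
  ultimately show ?thesis
    using finite_crossings by (simp add: bij_betw_def endo_inj_surj image_subsetI)
qed

lemma region_below_next_crossing: "region_below D (rot D (opp D c)) = region_above D c"
  using region_opp[of "opp D c"] by simp

text \<open>
  If all crossings have the same sign, this says that the in-degree and the out-degree of each
  vertex of the Tait graph agree.
\<close>

lemma card_corners:
  "card {c \<in> crossings D. region_above D c = v} = card {c \<in> crossings D. region_below D c = v}"
proof -
  have "bij_betw (\<lambda>c. rot D (opp D c)) {c \<in> crossings D. region_above D c = v}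
    {c \<in> crossings D. region_below D c = v}"
    using bij_betw_Collect[OF next_crossing_bij, of "\<lambda>c. region_below D c = v" "\<lambda>c. region_above D c = v"]
    by (simp add: region_below_next_crossing)
  then show ?thesis by (rule bij_betw_same_card)
qed

lemma tait_graph_connected:
  assumes "u \<in> unshaded D" and "v \<in> unshaded D"
  defines "R \<equiv> arcs_ends (tait_graph D) \<union> (arcs_ends (tait_graph D))\<inverse>"
  shows "(u, v) \<in> R\<^sup>*"
proof -
  \<comment> \<open>the unshaded one of the two regions next to a dart\<close>
  define U where "U d = (if region D d \<in> shaded D then region D (opp D d) else region D d)" for d
  have edge: "(region D c, region D (rot D (rot D c))) \<in> R"
    "(region D (rot D (rot D c)), region D c) \<in> R" if "c \<in> crossings D" for c
    using that by (cases "positive D c"; force simp: R_def arcs_ends_conv tait_graph_def)+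
  have U_opp: "U (opp D d) = U d" if "d \<in> darts D" for d
    using shaded_opp[OF that] by (simp add: U_def)
  have U_rot: "(U d, U (rot D d)) \<in> R\<^sup>*" if d: "d \<in> darts D" for d
  proof (cases "region D d \<in> shaded D")
    case False
    then show ?thesis using shaded_rot[OF d] by (simp add: U_def)
  next
    case True
    then have U: "U d = region D (rot D (rot D (rot D d)))" "U (rot D d) = region D (rot D d)"
      using shaded_rot[OF d] by (auto simp: U_def region_opp)
    show ?thesis
    proof (cases "d \<in> outgoing D")
      case out: True
      then show ?thesis
      proof (cases rule: outgoing_cases)
        case (1 c)
        then show ?thesis using True region_above_unshaded by simp
      next
        case (2 c)
        then show ?thesis using U edge by auto
      qed
    next
      case False
      with d show ?thesis
      proof (cases rule: incoming_cases)
        case (1 c)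
        then show ?thesis using True region_below_unshaded by simp
      next
        case (2 c)
        then show ?thesis using U edge by auto
      qed
    qed
  qed
  obtain d e where de: "d \<in> darts D" "e \<in> darts D" "u = region D d" "v = region D e"
    using assms by (auto simp: unshaded_def regions_def)
  then have uv: "u = U d" "v = U e" using assms by (auto simp: U_def unshaded_def)
  have "e \<in> darts D \<and> (U d, U e) \<in> R\<^sup>*"
    using connected[OF de(1,2)]
  proof induction
    case (step y z)
    then have "z \<in> darts D" "(U y, U z) \<in> R\<^sup>*" using U_rot[of y] U_opp[of y] by auto
    then show ?case using step.IH by (auto intro: rtrancl_trans)
  qed (use de in simp)
  then show ?thesis using uv by simp
qed

end

end

section \<open>The trace formula\<close>

theorem proposition4p3:
  fixes D :: "'d diagram" and vs :: "'d set list" and i :: nat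
  assumes "link_diagram D" and "special D" and "reduced D" and "alternating D"
    and "distinct vs" and "set vs = verts (tait_graph D)"
    and "i < length vs" and "vs ! i = unbounded D"
  defines "P \<equiv> diagram_poly D vs i"
  shows "poly P 0 \<noteq> 0
    \<and> FP D vs = - (poly (pderiv P) 0 / poly P 0)
    \<and> (coeff P 0 \<noteq> 0 \<longrightarrow> FP D vs = - (coeff P 1 / coeff P 0))"
proof -
  interpret link_diagram D by fact
  note special = \<open>special D\<close>
  let ?G = "tait_graph D" and ?w = "tait_weight D"
  have above: "region_above D c \<in> unshaded D" and below: "region_below D c \<in> unshaded D"
    if "c \<in> crossings D" for c
    using that region_above_unshaded[OF special that] region_below_unshaded[OF special that] crossing_in
    by (auto simp: unshaded_def)
  interpret G: enumerated_digraph ?G ?w vs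
  proof
    show "finite (verts ?G)" "finite (arcs ?G)"
      using finite_regions finite_crossings by (auto simp: tait_graph_def unshaded_def)
    show "tail ?G e \<in> verts ?G" "head ?G e \<in> verts ?G" if "e \<in> arcs ?G" for e
      using that above below by (auto simp: tait_graph_def)
    show "tail ?G e \<noteq> head ?G e" if "e \<in> arcs ?G" for e
      using that \<open>reduced D\<close> by (auto simp: tait_graph_def reduced_def nugatory_def)
  qed fact+
  obtain sgn where sgn: "\<And>c. c \<in> crossings D \<Longrightarrow> positive D c \<longleftrightarrow> sgn"
    using positive_constant[OF special \<open>alternating D\<close>] by blast
  define k :: real where "k = (if sgn then - 1 else 1)"
  have w: "?w e = k" if "e \<in> arcs ?G" for e
    using that sgn by (simp add: tait_weight_def tait_graph_def k_def)
  have out: "out_arcs ?G v = (if sgn then {c \<in> crossings D. region_below D c = v}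
      else {c \<in> crossings D. region_above D c = v})"
    and in': "in_arcs ?G v = (if sgn then {c \<in> crossings D. region_above D c = v}
      else {c \<in> crossings D. region_below D c = v})" for v
    using sgn by (auto simp: out_arcs_def in_arcs_def tait_graph_def)
  have bal: "G.balanced"
    unfolding G.balanced_def
  proof
    fix v
    have "sum ?w (out_arcs ?G v) = k * card (out_arcs ?G v)"
      using w by (simp add: out_arcs_def)
    also have "card (out_arcs ?G v) = card (in_arcs ?G v)"
      using card_corners[OF special, of v] by (simp add: out in')
    also have "k * card (in_arcs ?G v) = sum ?w (in_arcs ?G v)"
      using w by (simp add: in_arcs_def)
    finally show "sum ?w (out_arcs ?G v) = sum ?w (in_arcs ?G v)" .
  qed
  have "det (tait_laplacian D vs + diag_unit (length vs) i) \<noteq> 0"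
    unfolding tait_laplacian_def
  proof (rule G.det_laplacian_plus_diag_unit_nonzero[OF bal _ w _ \<open>i < length vs\<close>])
    show "k \<noteq> 0" by (simp add: k_def)
    show "(u, v) \<in> (arcs_ends ?G \<union> (arcs_ends ?G)\<inverse>)\<^sup>*" if "u \<in> verts ?G" "v \<in> verts ?G" for u v
      using tait_graph_connected[OF special, of u v] that by (simp add: tait_graph_def)
  qed
  note main = trace_moore_penrose_eq_coeff_ratio[OF
      G.laplacian_carrier \<open>i < length vs\<close> G.laplacian_row_sum G.laplacian_column_sum[OF bal]
      this[unfolded tait_laplacian_def]]
  have "coeff P 0 \<noteq> 0" and "FP D vs = - (coeff P 1 / coeff P 0)"
    using main by (simp_all add: P_def diagram_poly_def FP_def seifert_mat_def tait_laplacian_def Let_def)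
  moreover have "poly P 0 = coeff P 0" "poly (pderiv P) 0 = coeff P 1"
    by (simp_all add: poly_0_coeff_0 coeff_pderiv)
  ultimately show ?thesis by simp
qed

end
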